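(* There exists $m_0$ such that for every integer $m\ge m_0$ there is a hypergraph $H\in\mathcal{A}$ for which $H_{=m}$ has no $2$-shallow hitting set.
   Context: The family $\mathcal{A}$ consists of hypergraphs $H=(V,E)$ with $V\subset\mathbb{R}^2$ finite and every edge $e\in E$ of the form $V\cap\{(x,y): x_0<x<x_1\}$ or $V\cap\{(x,y): y_0<y<y_1\}$ for some reals $x_0,x_1,y_0,y_1$ (edges induced by axis-parallel strips). For a hypergraph $H$, $H_{=m}$ is the hypergraph on the same vertex set whose edges are the edges of $H$ of size exactly $m$. A set $U\subseteq V$ is a $c$-shallow hitting set of $(V,E)$ if $1\le|e\cap U|\le c$ for every $e\in E$. *)

theory Defs
  imports Complex_Main
begin

type_synonym 'a hypergraph = "'a set \<times> 'a set set"

abbreviation vertices :: "'a hypergraph \<Rightarrow> 'a set" where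
  "vertices H \<equiv> fst H"

abbreviation edges :: "'a hypergraph \<Rightarrow> 'a set set" where
  "edges H \<equiv> snd H"

(* Edges need not include every strip-induced subset of V: any collection of them is allowed. *)
definition strip_hypergraphs :: "(real \<times> real) hypergraph set" where
  "strip_hypergraphs = {(V, E). finite V \<and>
     (\<forall>e\<in>E. (\<exists>x0 x1. e = V \<inter> {(x, y). x0 < x \<and> x < x1}) \<or>
             (\<exists>y0 y1. e = V \<inter> {(x, y). y0 < y \<and> y < y1}))}"

definition edges_of_size :: "'a hypergraph \<Rightarrow> nat \<Rightarrow> 'a hypergraph" where
  "edges_of_size H m = (vertices H, {e \<in> edges H. finite e \<and> card e = m})"

definition shallow_hitting_set :: "nat \<Rightarrow> 'a hypergraph \<Rightarrow> 'a set \<Rightarrow> bool" where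
  "shallow_hitting_set c H U \<longleftrightarrow>
     U \<subseteq> vertices H \<and> (\<forall>e\<in>edges H. 1 \<le> card (e \<inter> U) \<and> card (e \<inter> U) \<le> c)"

end

theory Submission
  imports Defs "HOL-Library.Sublist"
begin

text \<open>
  After a generic choice of coordinates, axis-parallel strips are contiguous windows in two linear
  orders, written as lists \<open>xs\<close> and \<open>ys\<close>. With \<open>q = m div 4\<close> and \<open>r = m mod 4\<close>, points are grouped
  into cells of size about \<open>q\<close> or \<open>2 * q\<close>. A gadget of such cells, found by computer search,
  contains cells 14 and 15 that are unconstrained in the second order, yet every 2-shallow hitting set
  has a point in one of them. Five gadgets whose cells 14 and 15 are suitably interleaved in the
  second order are contradictory. The remainder \<open>r\<close> is absorbed by junk cells in the first order: all
  junk is put into a single window of the second order, so among three copies of this construction at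
  least one has no hitting point in its junk.
\<close>

section \<open>Windows in lists\<close>

text \<open>Counting list entries rather than taking a cardinality makes the count additive under
  append; on distinct lists the two agree.\<close>

definition count_in :: "'a set \<Rightarrow> 'a list \<Rightarrow> nat" where
  "count_in W xs = length (filter (\<lambda>x. x \<in> W) xs)"

definition shallow_hit :: "nat \<Rightarrow> 'a set \<Rightarrow> 'a list \<Rightarrow> bool" where
  "shallow_hit m W xs \<longleftrightarrow>
     (\<forall>w. sublist w xs \<longrightarrow> length w = m \<longrightarrow> 1 \<le> count_in W w \<and> count_in W w \<le> 2)"

lemma count_in_append: "count_in W (xs @ ys) = count_in W xs + count_in W ys"
  by (simp add: count_in_def)

lemma count_in_concat: "count_in W (concat xss) = (\<Sum>xs\<leftarrow>xss. count_in W xs)"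
  by (induction xss) (simp_all add: count_in_append, simp add: count_in_def)

lemma count_in_sublist_le: "sublist w xs \<Longrightarrow> count_in W w \<le> count_in W xs"
  by (auto simp: sublist_def count_in_append)

lemma count_in_distinct: "distinct xs \<Longrightarrow> count_in W xs = card (set xs \<inter> W)"
  by (simp add: count_in_def distinct_length_filter Int_commute)

lemma shallow_hit_sublist: "shallow_hit m W xs \<Longrightarrow> sublist ys xs \<Longrightarrow> shallow_hit m W ys"
  unfolding shallow_hit_def using sublist_order.order.trans by blast

text \<open>The prefix of length \<open>m\<close> is already a window of the exact size, and counts
  are monotone.\<close>

lemma shallow_hit_ge:
  assumes "shallow_hit m W xs" "sublist w xs" "m \<le> length w"
  shows "1 \<le> count_in W w"
proof -
  have "sublist (take m w) w" by simp
  moreover from this have "sublist (take m w) xs"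
    using assms(2) sublist_order.order.trans by blast
  ultimately show ?thesis
    using assms(1,3) count_in_sublist_le[of "take m w" w W]
    unfolding shallow_hit_def by force
qed

text \<open>A short window extends to one of length exactly \<open>m\<close>, provided the whole
  list is that long.\<close>

lemma shallow_hit_le:
  assumes "shallow_hit m W xs" "sublist w xs" "length w \<le> m" "m \<le> length xs"
  shows "count_in W w \<le> 2"
proof -
  obtain ps ss where xs: "xs = ps @ w @ ss" using assms(2) by (auto simp: sublist_def)
  \<comment> \<open>Start at the beginning of \<open>w\<close>, shifted left if fewer than
    \<open>m\<close> entries follow.\<close>
  define a where "a = min (length ps) (length xs - m)"
  have "a \<le> length ps" and len: "length ps - a + length w \<le> m"
    using assms(3,4) by (auto simp: a_def xs)
  then have "take m (drop a xs) =
      drop a ps @ w @ take (m - (length ps - a) - length w) ss"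
    by (simp add: xs)
  then have "sublist w (take m (drop a xs))" by (metis sublist_appendI)
  moreover have "sublist (take m (drop a xs)) xs"
    by (meson sublist_drop sublist_order.order.trans sublist_take)
  moreover have "length (take m (drop a xs)) = m"
    using assms(4) by (auto simp: a_def)
  ultimately show ?thesis
    using assms(1) count_in_sublist_le[of w _ W] unfolding shallow_hit_def by (meson le_trans)
qed

lemma sublist_concat_map:
  "sublist us vs \<Longrightarrow> sublist (concat (map f us)) (concat (map f vs))"
  by (auto simp: sublist_def) blast

lemma sublist_product:
  assumes "x \<in> set xs" "sublist us ys"
  shows "sublist (map (Pair x) us) (List.product xs ys)"
  using assms(1) map_mono_sublist[OF assms(2), of "Pair x"]
  by (induction xs) (auto simp: sublist_append)

lemma distinct_concat_map_Pair:
  assumes "distinct us"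
  shows "distinct (concat (map (\<lambda>u. map (Pair u) [0..<n u]) us))"
  using assms by (induction us) (auto simp: distinct_map inj_on_def)

lemma sum_list_product:
  "(\<Sum>u\<leftarrow>List.product xs ys. h u) = (\<Sum>x\<leftarrow>xs. \<Sum>y\<leftarrow>ys. h (x, y))"
  by (induction xs) (simp_all add: comp_def)

section \<open>From pairs of linear orders to strips\<close>

text \<open>Half-integer endpoints miss every integer position, so strict inequalities cut out
  exactly a block of consecutive positions.\<close>

lemma window_as_interval:
  assumes "distinct xs" "xs = ps @ w @ ss" "p \<in> set xs"
    and pos: "\<And>i. i < length xs \<Longrightarrow> pos (xs ! i) = i"
  shows "real (length ps) - 1/2 < real (pos p) \<and> real (pos p) < real (length ps + length w) - 1/2
           \<longleftrightarrow> p \<in> set w"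
proof -
  obtain i where i: "i < length xs" "p = xs ! i" using assms(3) by (metis in_set_conv_nth)
  have "p \<in> set w \<longleftrightarrow> length ps \<le> i \<and> i < length ps + length w"
  proof
    assume "p \<in> set w"
    then obtain j where j: "j < length w" "p = w ! j" by (metis in_set_conv_nth)
    then have "xs ! (length ps + j) = p" by (simp add: assms(2) nth_append)
    then have "i = length ps + j"
      using i j assms(1,2) by (metis add_less_cancel_left length_append nth_eq_iff_index_eq trans_less_add1)
    then show "length ps \<le> i \<and> i < length ps + length w" using j by simp
  next
    assume "length ps \<le> i \<and> i < length ps + length w"
    then have "xs ! i = w ! (i - length ps)" "i - length ps < length w"
      by (auto simp: assms(2) nth_append)
    then show "p \<in> set w" using i by simp
  qed
  then show ?thesis using pos[OF i(1)] i(2) by auto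
qed

lemma ex_positions:
  assumes "distinct xs"
  shows "\<exists>pos. \<forall>i < length xs. pos (xs ! i) = i"
  by (rule exI[of _ "inv_into {..<length xs} ((!) xs)"])
    (simp add: assms inj_on_nth)

text \<open>Place each point at its pair of indices in \<open>xs\<close> and \<open>ys\<close>.
  Windows of the lists become strip edges, and a hitting set pulls back along this injective
  placement.\<close>

lemma no_shallow_hitting_set_from_orders:
  fixes xs ys :: "'a list"
  assumes dx: "distinct xs" and dy: "distinct ys" and eq: "set xs = set ys"
    and none: "\<And>W. \<not> (shallow_hit m W xs \<and> shallow_hit m W ys)"
  shows "\<exists>H\<in>strip_hypergraphs. \<not> (\<exists>U. shallow_hitting_set 2 (edges_of_size H m) U)"
proof -
  obtain px py where px: "\<And>i. i < length xs \<Longrightarrow> px (xs ! i) = i"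
    and py: "\<And>i. i < length ys \<Longrightarrow> py (ys ! i) = i"
    using ex_positions[OF dx] ex_positions[OF dy] by metis
  define \<phi> where "\<phi> p = (real (px p), real (py p))" for p
  define V where "V = \<phi> ` set xs"
  \<comment> \<open>All strip-induced sets are taken, so it suffices that every window is one of
    them.\<close>
  define E where "E = {e. (\<exists>x0 x1. e = V \<inter> {(x, y). x0 < x \<and> x < x1}) \<or>
                          (\<exists>y0 y1. e = V \<inter> {(x, y). y0 < y \<and> y < y1})}"
  have inj: "inj_on \<phi> (set xs)"
  proof (rule inj_onI)
    fix p p' assume "p \<in> set xs" "p' \<in> set xs" "\<phi> p = \<phi> p'"
    then show "p = p'" using px by (metis \<phi>_def in_set_conv_nth of_nat_eq_iff prod.inject)
  qed
  have H: "(V, E) \<in> strip_hypergraphs"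
    by (auto simp: strip_hypergraphs_def V_def E_def)
  have "\<not> shallow_hitting_set 2 (edges_of_size (V, E) m) U" for U
  proof
    assume U: "shallow_hitting_set 2 (edges_of_size (V, E) m) U"
    define W where "W = {p. \<phi> p \<in> U}"
    have window: "1 \<le> count_in W w \<and> count_in W w \<le> 2"
      if e: "\<phi> ` set w \<in> E" and w: "distinct w" "set w \<subseteq> set xs" "length w = m" for w
    proof -
      have injw: "inj_on \<phi> (set w)" using inj w(2) inj_on_subset by blast
      then have "card (\<phi> ` set w) = m" using w by (simp add: card_image distinct_card)
      then have "\<phi> ` set w \<in> edges (edges_of_size (V, E) m)"
        using e by (simp add: edges_of_size_def)
      then have "1 \<le> card (\<phi> ` set w \<inter> U) \<and> card (\<phi> ` set w \<inter> U) \<le> 2"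
        using U by (simp add: shallow_hitting_set_def)
      moreover have "\<phi> ` set w \<inter> U = \<phi> ` (set w \<inter> W)" by (auto simp: W_def)
      moreover have "card (\<phi> ` (set w \<inter> W)) = card (set w \<inter> W)"
        using injw by (meson Int_lower1 card_image inj_on_subset)
      ultimately show ?thesis using w(1) by (simp add: count_in_distinct)
    qed
    have "shallow_hit m W xs" unfolding shallow_hit_def
    proof (intro allI impI)
      fix w assume w: "sublist w xs" "length w = m"
      then obtain ps ss where xs: "xs = ps @ w @ ss" by (auto simp: sublist_def)
      have "\<phi> ` set w = V \<inter> {(x, y). real (length ps) - 1/2 < x \<and> x < real (length ps + length w) - 1/2}"
        using window_as_interval[OF dx xs _ px] xs by (fastforce simp: V_def \<phi>_def)
      then have "\<phi> ` set w \<in> E" unfolding E_def by blast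
      then show "1 \<le> count_in W w \<and> count_in W w \<le> 2"
        using window[of w] w dx xs by auto
    qed
    moreover have "shallow_hit m W ys" unfolding shallow_hit_def
    proof (intro allI impI)
      fix w assume w: "sublist w ys" "length w = m"
      then obtain ps ss where ys: "ys = ps @ w @ ss" by (auto simp: sublist_def)
      have "\<phi> ` set w = V \<inter> {(x, y). real (length ps) - 1/2 < y \<and> y < real (length ps + length w) - 1/2}"
        using window_as_interval[OF dy ys _ py] ys eq by (fastforce simp: V_def \<phi>_def)
      then have "\<phi> ` set w \<in> E" unfolding E_def by blast
      moreover have "set w \<subseteq> set xs" unfolding eq by (auto simp: ys)
      ultimately show "1 \<le> count_in W w \<and> count_in W w \<le> 2"
        using window[of w] w dy ys by auto
    qed
    ultimately show False using none by blast
  qed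
  then show ?thesis using H by blast
qed

text \<open>Points missing from one list are appended at its end, which keeps all old windows. The
  two orders can thus be specified independently.\<close>

lemma no_shallow_hitting_set_from_partial_orders:
  fixes xs ys :: "'a list"
  assumes dx: "distinct xs" and dy: "distinct ys"
    and none: "\<And>W. \<not> (shallow_hit m W xs \<and> shallow_hit m W ys)"
  shows "\<exists>H\<in>strip_hypergraphs. \<not> (\<exists>U. shallow_hitting_set 2 (edges_of_size H m) U)"
proof (rule no_shallow_hitting_set_from_orders)
  let ?xs = "xs @ filter (\<lambda>p. p \<notin> set xs) ys" and ?ys = "ys @ filter (\<lambda>p. p \<notin> set ys) xs"
  show "distinct ?xs" "distinct ?ys" "set ?xs = set ?ys" using dx dy by auto
  have "sublist xs ?xs" "sublist ys ?ys" by auto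
  then show "\<not> (shallow_hit m W ?xs \<and> shallow_hit m W ?ys)" for W
    using none shallow_hit_sublist by blast
qed

section \<open>The gadget\<close>

text \<open>
  Cell \<open>c\<close> of gadget \<open>t\<close> carries the points \<open>((t, c), i)\<close>; cells 18 to 21 are junk. Windows of the
  first order are only used for lower bounds, so each of them contains a junk cell to reach size \<open>m\<close>.
  Windows of the second order give upper bounds, except that 17, 13, 6 also gives a lower bound, which
  is why cell 17 has size \<open>q + r\<close>.
\<close>

definition cell_size :: "nat \<Rightarrow> nat \<Rightarrow> nat \<Rightarrow> nat" where
  "cell_size q r c =
     (if c \<in> {0, 6, 10} then 2 * q else if c = 17 then q + r else if 18 \<le> c then r else q)"

definition points :: "nat \<Rightarrow> nat \<Rightarrow> (nat \<times> nat) list \<Rightarrow> ((nat \<times> nat) \<times> nat) list" where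
  "points q r us = concat (map (\<lambda>u. map (Pair u) [0..<cell_size q r (snd u)]) us)"

definition gadget_x :: "nat list" where
  "gadget_x = [0,1,2,18,3,4,5,6,19,7,8,9,10,20,11,12,13,14,15,21,16,17]"

definition gadget_y :: "nat list" where
  "gadget_y = [11,1,8,5,10,7,4,17,13,6,16,12,2,9,3,0]"

text \<open>The two cells of \<open>t\<close> flank those of \<open>t+1\<close> together with
  \<open>(t+2, 14)\<close>; the two cells of \<open>t+3\<close> flank those of \<open>t+4\<close>
  together with \<open>(t+2, 15)\<close>. Each flanked block will bar gadget \<open>t+2\<close> from
  one of its two cells.\<close>

definition interleaving :: "nat \<Rightarrow> (nat \<times> nat) list" where
  "interleaving t =
     [(t, 14), (t+1, 14), (t+1, 15), (t+2, 14), (t, 15),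
      (t+3, 14), (t+2, 15), (t+4, 14), (t+4, 15), (t+3, 15)]"

definition order_x :: "(nat \<times> nat) list" where
  "order_x = List.product [0..<15] gadget_x"

definition order_y :: "(nat \<times> nat) list" where
  "order_y = List.product [0..<15] gadget_y @ interleaving 0 @ interleaving 5 @ interleaving 10 @
     List.product [0..<15] [18,19,20,21]"

section \<open>Point lists as blow-ups of cell orders\<close>

lemma distinct_order_x: "distinct order_x"
  by (simp add: order_x_def gadget_x_def distinct_product)

lemma distinct_order_y: "distinct order_y"
  by (auto simp: order_y_def gadget_y_def interleaving_def distinct_product)

lemma distinct_points: "distinct us \<Longrightarrow> distinct (points q r us)"
  unfolding points_def by (rule distinct_concat_map_Pair)

lemma length_points: "length (points q r us) = (\<Sum>u\<leftarrow>us. cell_size q r (snd u))"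
  by (simp add: points_def length_concat comp_def)

lemma count_in_points: "count_in W (points q r us) = (\<Sum>u\<leftarrow>us. count_in W (points q r [u]))"
  by (simp add: points_def count_in_concat comp_def)

lemma sublist_points: "sublist us vs \<Longrightarrow> sublist (points q r us) (points q r vs)"
  unfolding points_def by (rule sublist_concat_map)

section \<open>Forcing in one gadget and the contradiction between gadgets\<close>

text \<open>Let cells 14 and 15 be empty. Whichever of 13 and 16 are hit, 6 is empty and 4, 7 share
  at most one point, which forces a hit in 9. If 13 is empty, the hits in 12 and 16 exclude this;
  otherwise 1, 2, 4 turn out empty, so 0, 3 and 9 are all hit and overfill their window.\<close>

lemma gadget_forces:
  fixes f :: "nat \<Rightarrow> nat"
  assumes x: "1 \<le> f 0 + f 1 + f 2" "1 \<le> f 1 + f 2 + f 3 + f 4" "1 \<le> f 4 + f 5 + f 6"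
      "1 \<le> f 5 + f 6 + f 7" "1 \<le> f 6 + f 7 + f 8" "1 \<le> f 8 + f 9 + f 10"
      "1 \<le> f 9 + f 10 + f 11" "1 \<le> f 10 + f 11 + f 12" "1 \<le> f 12 + f 13 + f 14 + f 15"
      "1 \<le> f 13 + f 14 + f 15 + f 16" "1 \<le> f 14 + f 15 + f 16 + f 17"
    and y: "f 11 + f 1 + f 8 + f 5 \<le> 2" "f 8 + f 5 + f 10 \<le> 2" "f 5 + f 10 + f 7 \<le> 2"
      "f 7 + f 4 + f 17 + f 13 \<le> 2" "f 17 + f 13 + f 6 \<le> 2" "f 13 + f 6 + f 16 \<le> 2"
      "f 6 + f 16 + f 12 \<le> 2" "f 16 + f 12 + f 2 + f 9 \<le> 2" "f 9 + f 3 + f 0 \<le> 2"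
      "1 \<le> f 17 + f 13 + f 6"
  shows "1 \<le> f 14 + f 15"
proof (rule ccontr)
  assume "\<not> ?thesis"
  then have z: "f 14 = 0" "f 15 = 0" by simp_all
  \<comment> \<open>If 5 were empty, both 4 and 7 would be hit. With 5 hit and one of 7, 8 hit, a
    hit in 10 would make a third point in a window.\<close>
  have f5: "1 \<le> f 5" and f10: "f 10 = 0" if "f 6 = 0" "f 7 + f 4 \<le> 1"
  proof -
    show f5: "1 \<le> f 5" using x(3,4) that by linarith
    show "f 10 = 0" using x(5) y(2,3) f5 that(1) by linarith
  qed
  have f9: "f 9 \<noteq> 0" if "f 6 = 0" "f 7 + f 4 \<le> 1"
    using x(6,7) y(1) f5[OF that] f10[OF that] by linarith
  have f3: "1 \<le> f 3" "1 \<le> f 0" if "f 1 = 0" "f 2 = 0" "f 4 = 0"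
    using x(1,2) that by linarith+
  consider "f 13 = 0" | "1 \<le> f 13" "f 16 = 0" | "1 \<le> f 13" "1 \<le> f 16" by linarith
  then show False
  proof cases
    case 1
    then have "1 \<le> f 12" "1 \<le> f 16" using x(9,10) z by simp_all
    then have "f 6 = 0" "f 9 = 0" using y(7,8) by linarith+
    \<comment> \<open>The only use of the lower bound from the second order: 17 must be hit, so 4
      and 7 share at most one point.\<close>
    then show False using f9 y(4,10) 1 by linarith
  next
    case 2
    then have "1 \<le> f 17" using x(11) z by simp
    then have "f 6 = 0" "f 7 = 0" "f 4 = 0" using y(4,5) 2(1) by linarith+
    then have "1 \<le> f 5" "1 \<le> f 8" "1 \<le> f 9" "f 10 = 0" using f5 f9 f10 x(5) by simp_all
    then have "f 11 = 0" "f 1 = 0" using y(1) by linarith+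
    then have "1 \<le> f 12" using x(8) \<open>f 10 = 0\<close> by linarith
    then have "f 2 = 0" using y(8) \<open>1 \<le> f 9\<close> by linarith
    then show False using f3 y(9) \<open>1 \<le> f 9\<close> \<open>f 1 = 0\<close> \<open>f 4 = 0\<close> by linarith
  next
    case 3
    then have 6: "f 6 = 0" and 74: "f 7 + f 4 \<le> 1" using y(4,6) by linarith+
    have 9: "1 \<le> f 9" using f9[OF 6 74] by simp
    then have "f 12 = 0" "f 2 = 0" using y(8) 3(2) by linarith+
    then have "1 \<le> f 11" using x(8) f10[OF 6 74] by linarith
    then have "f 1 = 0" "f 8 = 0" using y(1) f5[OF 6 74] by linarith+
    then have "f 4 = 0" using x(5) 6 74 by linarith
    then show False using f3 y(9) 9 \<open>f 1 = 0\<close> \<open>f 2 = 0\<close> by linarith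
  qed
qed

text \<open>The bound \<open>60 * r \<le> m\<close> makes the 15 * 4 junk cells of \<open>r\<close>
  points each fit into one window.\<close>

lemma orders_not_shallow_hit:
  assumes m: "m = 4 * q + r" and r: "60 * r \<le> m"
    and hx: "shallow_hit m W (points q r order_x)"
    and hy: "shallow_hit m W (points q r order_y)"
  shows False
proof -
  define f where "f t c = count_in W (points q r [(t, c)])" for t c
  define total where "total us = (\<Sum>u\<leftarrow>us. f (fst u) (snd u))" for us
  have total: "count_in W (points q r us) = total us" for us
    unfolding count_in_points[of W q r us] f_def total_def by simp
  have copy_x: "sublist (map (Pair t) us) order_x" if "t < 15" "sublist us gadget_x" for t us
    using that unfolding order_x_def by (intro sublist_product) auto
  have copy_y: "sublist (map (Pair t) us) order_y" if "t < 15" "sublist us gadget_y" for t us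
    using that unfolding order_y_def sublist_append by (intro disjI1 sublist_product) auto
  have lower_x: "1 \<le> total (map (Pair t) us)"
    if "t < 15" "sublist us gadget_x" "m \<le> (\<Sum>c\<leftarrow>us. cell_size q r c)" for t us
    using shallow_hit_ge[OF hx sublist_points[OF copy_x[OF that(1,2)]]] that(3)
    by (simp add: total length_points comp_def)
  have lower_y: "1 \<le> total (map (Pair t) us)"
    if "t < 15" "sublist us gadget_y" "m \<le> (\<Sum>c\<leftarrow>us. cell_size q r c)" for t us
    using shallow_hit_ge[OF hy sublist_points[OF copy_y[OF that(1,2)]]] that(3)
    by (simp add: total length_points comp_def)
  \<comment> \<open>These cells hold exactly \<open>4 * q + r = m\<close> points, so upper bounds
    apply to all shorter windows of the second order.\<close>
  have "sublist (map (Pair 0) [17,13,6]) order_y"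
    by (rule copy_y) (simp_all add: gadget_y_def sublist_Cons_right)
  then have "length (points q r (map (Pair 0) [17,13,6])) \<le> length (points q r order_y)"
    by (intro sublist_length_le sublist_points)
  then have long: "m \<le> length (points q r order_y)"
    by (simp add: length_points cell_size_def m)
  have upper: "total us \<le> 2" if "sublist us order_y" "(\<Sum>u\<leftarrow>us. cell_size q r (snd u)) \<le> m" for us
    using shallow_hit_le[OF hy sublist_points[OF that(1)] _ long] that(2)
    by (simp add: total length_points)
  have upper_y: "total (map (Pair t) us) \<le> 2"
    if "t < 15" "sublist us gadget_y" "(\<Sum>c\<leftarrow>us. cell_size q r c) \<le> m" for t us
    using upper[OF copy_y[OF that(1,2)]] that(3) by (simp add: comp_def)
  \<comment> \<open>Each window of the first order used here has exactly one junk cell, which brings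
    it up to at least \<open>m\<close> points but contributes no hit.\<close>
  have forced: "1 \<le> f t 14 + f t 15"
    if t: "t < 15" and junk: "f t 18 = 0" "f t 19 = 0" "f t 20 = 0" "f t 21 = 0" for t
  proof (rule gadget_forces)
    note lx = lower_x[OF t] and ly = lower_y[OF t] and uy = upper_y[OF t]
    note simps = total_def junk gadget_x_def gadget_y_def sublist_Cons_right cell_size_def m
    show "1 \<le> f t 0 + f t 1 + f t 2" using lx[of "[0,1,2,18]"] by (simp add: simps)
    show "1 \<le> f t 1 + f t 2 + f t 3 + f t 4" using lx[of "[1,2,18,3,4]"] by (simp add: simps)
    show "1 \<le> f t 4 + f t 5 + f t 6" using lx[of "[4,5,6,19]"] by (simp add: simps)
    show "1 \<le> f t 5 + f t 6 + f t 7" using lx[of "[5,6,19,7]"] by (simp add: simps)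
    show "1 \<le> f t 6 + f t 7 + f t 8" using lx[of "[6,19,7,8]"] by (simp add: simps)
    show "1 \<le> f t 8 + f t 9 + f t 10" using lx[of "[8,9,10,20]"] by (simp add: simps)
    show "1 \<le> f t 9 + f t 10 + f t 11" using lx[of "[9,10,20,11]"] by (simp add: simps)
    show "1 \<le> f t 10 + f t 11 + f t 12" using lx[of "[10,20,11,12]"] by (simp add: simps)
    show "1 \<le> f t 12 + f t 13 + f t 14 + f t 15" using lx[of "[12,13,14,15,21]"] by (simp add: simps)
    show "1 \<le> f t 13 + f t 14 + f t 15 + f t 16" using lx[of "[13,14,15,21,16]"] by (simp add: simps)
    show "1 \<le> f t 14 + f t 15 + f t 16 + f t 17" using lx[of "[14,15,21,16,17]"] by (simp add: simps)
    show "f t 11 + f t 1 + f t 8 + f t 5 \<le> 2" using uy[of "[11,1,8,5]"] by (simp add: simps)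
    show "f t 8 + f t 5 + f t 10 \<le> 2" using uy[of "[8,5,10]"] by (simp add: simps)
    show "f t 5 + f t 10 + f t 7 \<le> 2" using uy[of "[5,10,7]"] by (simp add: simps)
    show "f t 7 + f t 4 + f t 17 + f t 13 \<le> 2" using uy[of "[7,4,17,13]"] by (simp add: simps)
    show "f t 17 + f t 13 + f t 6 \<le> 2" using uy[of "[17,13,6]"] by (simp add: simps)
    show "f t 13 + f t 6 + f t 16 \<le> 2" using uy[of "[13,6,16]"] by (simp add: simps)
    show "f t 6 + f t 16 + f t 12 \<le> 2" using uy[of "[6,16,12]"] by (simp add: simps)
    show "f t 16 + f t 12 + f t 2 + f t 9 \<le> 2" using uy[of "[16,12,2,9]"] by (simp add: simps)
    show "f t 9 + f t 3 + f t 0 \<le> 2" using uy[of "[9,3,0]"] by (simp add: simps)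
    show "1 \<le> f t 17 + f t 13 + f t 6" using ly[of "[17,13,6]"] by (simp add: simps)
  qed
  define junk where "junk t = f t 18 + f t 19 + f t 20 + f t 21" for t
  let ?junk_cells = "List.product [0..<15] [18,19,20,21]"
  have "total ?junk_cells \<le> 2"
  proof (rule upper)
    show "sublist ?junk_cells order_y" by (simp add: order_y_def sublist_append)
    show "(\<Sum>u\<leftarrow>?junk_cells. cell_size q r (snd u)) \<le> m"
      using r by (simp add: sum_list_product cell_size_def interv_sum_list_conv_sum_set_nat)
  qed
  then have "sum junk {0..<15} \<le> 2"
    by (simp add: total_def junk_def sum_list_product interv_sum_list_conv_sum_set_nat add.assoc)
  \<comment> \<open>At most two junk hits are spread over three groups of five gadgets, so some
    group has none.\<close>
  moreover have "sum junk {0..<15} = sum junk {0..<0+5} + sum junk {5..<5+5} + sum junk {10..<10+5}"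
    by (simp add: sum.atLeastLessThan_concat)
  ultimately have "sum junk {0..<0+5} = 0 \<or> sum junk {5..<5+5} = 0 \<or> sum junk {10..<10+5} = 0"
    by linarith
  then obtain g where "g \<in> {0, 5, 10}" "sum junk {g..<g+5} = 0" by blast
  then have g: "g \<in> {0, 5, 10}" "\<And>j. j < 5 \<Longrightarrow> junk (g + j) = 0" by simp_all
  have pair: "1 \<le> f (g + j) 14 + f (g + j) 15" if "j < 5" for j
    using g that forced[of "g + j"] by (auto simp: junk_def)
  have "sublist (interleaving g) order_y"
    using g(1) by (auto simp: order_y_def sublist_append)
  then have window: "total us \<le> 2"
    if "sublist us (interleaving g)" "(\<Sum>u\<leftarrow>us. cell_size q r (snd u)) \<le> m" for us
    using upper that sublist_order.order.trans by blast
  have w: "f g 14 + f (g+1) 14 + f (g+1) 15 + f (g+2) 14 \<le> 2"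
      "f (g+1) 14 + f (g+1) 15 + f (g+2) 14 + f g 15 \<le> 2"
      "f (g+3) 14 + f (g+2) 15 + f (g+4) 14 + f (g+4) 15 \<le> 2"
      "f (g+2) 15 + f (g+4) 14 + f (g+4) 15 + f (g+3) 15 \<le> 2"
    using window[of "[(g,14), (g+1,14), (g+1,15), (g+2,14)]"]
      window[of "[(g+1,14), (g+1,15), (g+2,14), (g,15)]"]
      window[of "[(g+3,14), (g+2,15), (g+4,14), (g+4,15)]"]
      window[of "[(g+2,15), (g+4,14), (g+4,15), (g+3,15)]"]
    by (simp_all add: interleaving_def sublist_Cons_right total_def cell_size_def m)
  \<comment> \<open>Adding both windows counts gadget \<open>g\<close> once and gadget
    \<open>g+1\<close> twice, at least 3 in total; the bound 4 leaves at most 1 for twice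
    \<open>f (g+2) 14\<close>.\<close>
  have "f (g+2) 14 = 0" using w(1,2) pair[of 0] pair[of 1] by simp
  moreover have "f (g+2) 15 = 0" using w(3,4) pair[of 3] pair[of 4] by simp
  ultimately show False using pair[of 2] by simp
qed

theorem theorem3:
  shows "\<exists>m0::nat. \<forall>m::nat. m \<ge> m0 \<longrightarrow>
           (\<exists>H\<in>strip_hypergraphs. \<not> (\<exists>U. shallow_hitting_set 2 (edges_of_size H m) U))"
proof (intro exI[of _ 180] allI impI)
  fix m :: nat
  assume "180 \<le> m"
  define q r where "q = m div 4" and "r = m mod 4"
  have m: "m = 4 * q + r" by (simp add: q_def r_def)
  have "r < 4" by (simp add: r_def)
  \<comment> \<open>The threshold 180 is 60 times the largest remainder 3.\<close>
  then have r: "60 * r \<le> m" using \<open>180 \<le> m\<close> by linarith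
  show "\<exists>H\<in>strip_hypergraphs. \<not> (\<exists>U. shallow_hitting_set 2 (edges_of_size H m) U)"
  proof (rule no_shallow_hitting_set_from_partial_orders)
    show "distinct (points q r order_x)" "distinct (points q r order_y)"
      by (intro distinct_points distinct_order_x distinct_order_y)+
    show "\<not> (shallow_hit m W (points q r order_x) \<and> shallow_hit m W (points q r order_y))" for W
      using orders_not_shallow_hit[OF m r] by blast
  qed
qed

end
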